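(* Let $T$ be a triangle in $\mathbb{R}^2$ and $d\geq 1$ an integer. Let $$w_{ijk} := \frac{A_T}{\binom{d+2}{2}}\,\sigma_{ijk}(\mathbf{B}^{-1}),\qquad i+j+k=d,$$ where $\sigma_{ijk}(\mathbf{B}^{-1})$ is the $ijk$-th column sum (columns in lexicographical order) of $\mathbf{B}^{-1}$. Then the quadrature rule $\sum_{i+j+k=d}w_{ijk}f(\xi_{ijk})\approx\int_T f(x,y)\,dx\,dy$ with the domain points $\xi_{ijk}$ as quadrature points and weights $w_{ijk}$ is exact for all polynomials of degree at most $d$, that is, $$\sum_{i+j+k=d}w_{ijk}\,\chi(\xi_{ijk}) = \int_T\chi(x,y)\,dx\,dy\qquad \forall\, \chi\in\mathbb{P}_d.$$
   Context: $T$ is a nondegenerate triangle with vertices $(x_1,y_1),(x_2,y_2),(x_3,y_3)$ and area $A_T$. $\mathbb{P}_d$ is the space of bivariate real polynomials of total degree at most $d$; $\dim\mathbb{P}_d=\binom{d+2}{2}$. Indices $(i,j,k)$ are triples of nonnegative integers. For $(x,y)\in\mathbb{R}^2$, the barycentric coordinates $(b_1,b_2,b_3)$ with respect to $T$ are the solution of $x=b_1x_1+b_2x_2+b_3x_3$, $y=b_1y_1+b_2y_2+b_3y_3$, $1=b_1+b_2+b_3$. The Bernstein--Bézier polynomials of degree $d$ are $B^T_{ijk}(x,y)=\frac{d!}{i!\,j!\,k!}b_1^ib_2^jb_3^k$, $i+j+k=d$ (the superscript $T$ denotes dependence on the triangle). The domain points of degree $d$ are $\xi_{ijk}=\frac{i(x_1,y_1)+j(x_2,y_2)+k(x_3,y_3)}{d}$,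 $i+j+k=d$. $\mathbf{B}\in\mathbb{R}^{\dim\mathbb{P}_d\times\dim\mathbb{P}_d}$ is the matrix with entries $B^T_{lmn}(\xi_{ijk})$, with $ijk$ the row index and $lmn$ the column index, rows and columns both in lexicographical order; it is invertible, since polynomial interpolation in $\mathbb{P}_d$ at the domain points is uniquely solvable. The columns of $\mathbf{B}^{-1}$ are thus indexed by the triples $ijk$. *)

theory Defs
  imports "HOL-Analysis.Analysis" "Jordan_Normal_Form.Gauss_Jordan_Elimination"
begin

type_synonym point = "real \<times> real"

type_synonym multi_index = "nat \<times> nat \<times> nat"

definition bivariate_polys :: "nat \<Rightarrow> (point \<Rightarrow> real) set" where
  "bivariate_polys d = {p. \<exists>c :: nat \<Rightarrow> nat \<Rightarrow> real.
     p = (\<lambda>(x, y). \<Sum>(a, b) \<in> {(a, b). a + b \<le> d}. c a b * x ^ a * y ^ b)}"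

definition barycentric :: "point \<Rightarrow> point \<Rightarrow> point \<Rightarrow> point \<Rightarrow> real \<times> real \<times> real" where
  "barycentric v1 v2 v3 p = (THE (b1, b2, b3).
     fst p = b1 * fst v1 + b2 * fst v2 + b3 * fst v3 \<and>
     snd p = b1 * snd v1 + b2 * snd v2 + b3 * snd v3 \<and>
     1 = b1 + b2 + b3)"

definition bernstein :: "nat \<Rightarrow> point \<Rightarrow> point \<Rightarrow> point \<Rightarrow> multi_index \<Rightarrow> point \<Rightarrow> real" where
  "bernstein d v1 v2 v3 = (\<lambda>(i, j, k) p.
     let (b1, b2, b3) = barycentric v1 v2 v3 p
     in fact d / (fact i * fact j * fact k) * b1 ^ i * b2 ^ j * b3 ^ k)"

definition domain_point :: "nat \<Rightarrow> point \<Rightarrow> point \<Rightarrow> point \<Rightarrow> multi_index \<Rightarrow> point" where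
  "domain_point d v1 v2 v3 = (\<lambda>(i, j, k).
     (real i *\<^sub>R v1 + real j *\<^sub>R v2 + real k *\<^sub>R v3) /\<^sub>R real d)"

definition indices :: "nat \<Rightarrow> multi_index set" where
  "indices d = {(i, j, k). i + j + k = d}"

definition lex_indices :: "nat \<Rightarrow> multi_index list" where
  "lex_indices d = concat (map (\<lambda>i. map (\<lambda>j. (i, j, d - i - j)) [0..<Suc (d - i)]) [0..<Suc d])"

lemma set_lex_indices: "set (lex_indices d) = indices d"
  unfolding lex_indices_def indices_def by (auto simp: image_iff simp del: upt_Suc)

lemma sorted_lex_indices:
  "sorted_wrt (\<lambda>s t. (s, t) \<in> less_than <*lex*> less_than <*lex*> less_than) (lex_indices d)"
proof -
  have "sorted_wrt (\<lambda>s t. (s, t) \<in> less_than <*lex*> less_than <*lex*> less_than)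
      (concat (map (\<lambda>i. map (\<lambda>j. (i, j, d - i - j)) [0..<m i]) [0..<n]))"
    for m :: "nat \<Rightarrow> nat" and n
    by (induction n)
      (auto simp: sorted_wrt_append sorted_wrt_map intro: sorted_wrt_mono_rel[OF _ sorted_wrt_upt])
  from this[of "\<lambda>i. Suc (d - i)"] show ?thesis unfolding lex_indices_def .
qed

lemma length_lex_indices: "length (lex_indices d) = (d + 2) choose 2"
proof -
  have "length (lex_indices d) = (\<Sum>i\<le>d. Suc (d - i))"
    unfolding lex_indices_def
    by (simp add: length_concat comp_def interv_sum_list_conv_sum_set_nat atLeast0LessThan
        lessThan_Suc_atMost del: upt_Suc)
  also have "\<dots> = (\<Sum>i\<le>d. Suc i)"
    by (rule sum.nat_diff_reindex[of "\<lambda>i. Suc i" "Suc d", unfolded lessThan_Suc_atMost, simplified])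
  also have "\<dots> = (d + 2) choose 2"
    by (induction d) (simp_all add: numeral_2_eq_2)
  finally show ?thesis .
qed

definition lex_pos :: "nat \<Rightarrow> multi_index \<Rightarrow> nat" where
  "lex_pos d t = (THE n. n < length (lex_indices d) \<and> lex_indices d ! n = t)"

definition collocation_mat :: "nat \<Rightarrow> point \<Rightarrow> point \<Rightarrow> point \<Rightarrow> real Matrix.mat" where
  "collocation_mat d v1 v2 v3 = Matrix.mat ((d + 2) choose 2) ((d + 2) choose 2)
     (\<lambda>(r, c). bernstein d v1 v2 v3 (lex_indices d ! c)
                 (domain_point d v1 v2 v3 (lex_indices d ! r)))"

definition column_sum :: "real Matrix.mat \<Rightarrow> nat \<Rightarrow> real" where
  "column_sum A c = (\<Sum>r < dim_row A. A $$ (r, c))"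

text \<open>\<open>mat_inverse\<close> is option-valued; \<open>the\<close> is meaningful here because the collocation matrix of a
  nondegenerate triangle is invertible for \<open>d \<ge> 1\<close>.\<close>
definition weight :: "nat \<Rightarrow> point \<Rightarrow> point \<Rightarrow> point \<Rightarrow> multi_index \<Rightarrow> real" where
  "weight d v1 v2 v3 t =
     measure lebesgue (convex hull {v1, v2, v3}) / real ((d + 2) choose 2)
       * column_sum (the (mat_inverse (collocation_mat d v1 v2 v3))) (lex_pos d t)"

end

theory Submission
  imports Defs "Jordan_Normal_Form.Determinant"
begin

text \<open>
  Every Bernstein polynomial of degree \<open>d\<close> has the same integral \<open>A\<^sub>T / (d + 2 choose 2)\<close> over the
  triangle, by an affine change of variables and the Beta integral. A polynomial \<open>p\<close> of degree at
  most \<open>d\<close> is homogeneous of degree \<open>d\<close> in the barycentric coordinates, since \<open>b\<^sub>1 + b\<^sub>2 + b\<^sub>3 = 1\<close>, and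
  hence \<open>p = (\<Sum>t. c\<^sub>t B\<^sub>t)\<close>, so its integral is a multiple of the coefficient sum. The values of \<open>p\<close> at the
  domain points are the entries of the collocation matrix times \<open>c\<close>, so applying the column sums
  of the inverse matrix to them returns the coefficient sum as well. The Bernstein coefficients of the Lagrange
  polynomials of the domain points form a right inverse of the collocation matrix, which is thus invertible.
\<close>

section \<open>Affine geometry of a triangle and its barycentric coordinates\<close>

definition cross2 :: "point \<Rightarrow> point \<Rightarrow> real" where
  "cross2 u w = fst u * snd w - snd u * fst w"

text \<open>Twice the signed area of the triangle, and also the Jacobian determinant of
  \<open>tri_point\<close>.\<close>

definition tri_det :: "point \<Rightarrow> point \<Rightarrow> point \<Rightarrow> real" where
  "tri_det v1 v2 v3 = cross2 (v1 - v3) (v2 - v3)"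

text \<open>Eliminating the third barycentric coordinate makes the whole plane the parameter domain,
  with the standard simplex corresponding to the triangle.\<close>

definition tri_point :: "point \<Rightarrow> point \<Rightarrow> point \<Rightarrow> real \<times> real \<Rightarrow> point" where
  "tri_point v1 v2 v3 = (\<lambda>(x, y). x *\<^sub>R v1 + y *\<^sub>R v2 + (1 - x - y) *\<^sub>R v3)"

text \<open>With \<open>v3\<close> translated to the origin, a vanishing cross product makes the two
  edge vectors parallel.\<close>

lemma tri_det_nonzero:
  assumes "\<not> collinear {v1, v2, v3}"
  shows "tri_det v1 v2 v3 \<noteq> 0"
proof
  assume D: "tri_det v1 v2 v3 = 0"
  define u w where "u = v1 - v3" and "w = v2 - v3"
  have "collinear {0, u, w}"
  proof (cases "u = 0")
    case False
    have eq: "fst u * snd w = snd u * fst w"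
      using D by (simp add: tri_det_def cross2_def u_def w_def)
    have "\<exists>c. w = c *\<^sub>R u"
    proof (cases "fst u = 0")
      case True
      with False have "snd u \<noteq> 0" by (simp add: prod_eq_iff)
      with eq True show ?thesis
        by (intro exI[of _ "snd w / snd u"]) (simp add: prod_eq_iff)
    next
      case False
      with eq show ?thesis
        by (intro exI[of _ "fst w / fst u"]) (simp add: prod_eq_iff field_simps)
    qed
    then show ?thesis by (simp add: collinear_lemma)
  qed simp
  moreover have "collinear {v1, v3, v2} \<longleftrightarrow> collinear {0, v1 - v3, v2 - v3}"
    by (auto simp: collinear_def)
  ultimately show False
    using assms by (simp add: u_def w_def insert_commute)
qed

text \<open>With \<open>c\<close> eliminated, the differences \<open>a - x\<close> and
  \<open>b - y\<close> solve a homogeneous 2 by 2 system of determinant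
  \<open>tri_det v1 v2 v3\<close>, hence vanish. This uniqueness gives the definite description in
  \<open>barycentric\<close> its meaning.\<close>

lemma barycentric_tri_point:
  assumes "tri_det v1 v2 v3 \<noteq> 0"
  shows "barycentric v1 v2 v3 (tri_point v1 v2 v3 (x, y)) = (x, y, 1 - x - y)"
proof -
  have "a = x \<and> b = y \<and> c = 1 - x - y"
    if 1: "fst (tri_point v1 v2 v3 (x, y)) = a * fst v1 + b * fst v2 + c * fst v3"
      and 2: "snd (tri_point v1 v2 v3 (x, y)) = a * snd v1 + b * snd v2 + c * snd v3"
      and 3: "1 = a + b + c" for a b c
  proof -
    have c: "c = 1 - a - b" using 3 by simp
    define u1 u2 w1 w2 where uw: "u1 = fst v1 - fst v3" "u2 = snd v1 - snd v3"
      "w1 = fst v2 - fst v3" "w2 = snd v2 - snd v3"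
    have e1: "(a - x) * u1 + (b - y) * w1 = 0"
      using 1 unfolding c uw tri_point_def by (simp add: algebra_simps)
    have e2: "(a - x) * u2 + (b - y) * w2 = 0"
      using 2 unfolding c uw tri_point_def by (simp add: algebra_simps)
    have D: "tri_det v1 v2 v3 = u1 * w2 - u2 * w1"
      by (simp add: tri_det_def cross2_def uw)
    have "(a - x) * tri_det v1 v2 v3 = ((a - x) * u1 + (b - y) * w1) * w2 - ((a - x) * u2 + (b - y) * w2) * w1"
      by (simp add: D algebra_simps)
    moreover have "(b - y) * tri_det v1 v2 v3 = ((a - x) * u2 + (b - y) * w2) * u1 - ((a - x) * u1 + (b - y) * w1) * u2"
      by (simp add: D algebra_simps)
    ultimately have "(a - x) * tri_det v1 v2 v3 = 0" "(b - y) * tri_det v1 v2 v3 = 0"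
      unfolding e1 e2 by simp_all
    with assms c show ?thesis by simp
  qed
  then show ?thesis
    unfolding barycentric_def
    by (intro the_equality) (auto simp: tri_point_def)
qed

text \<open>The parameters come from Cramer's rule, applied to expressing \<open>p - v3\<close> in
  the edge vectors \<open>v1 - v3\<close> and \<open>v2 - v3\<close>.\<close>

lemma tri_point_surj:
  assumes "tri_det v1 v2 v3 \<noteq> 0"
  shows "tri_point v1 v2 v3
    (cross2 (p - v3) (v2 - v3) / tri_det v1 v2 v3, cross2 (v1 - v3) (p - v3) / tri_det v1 v2 v3) = p"
proof -
  define u w q where uwq: "u = v1 - v3" "w = v2 - v3" "q = p - v3"
  define D where "D = cross2 u w"
  have D: "tri_det v1 v2 v3 = D" "D \<noteq> 0"
    using assms by (auto simp: D_def tri_det_def uwq)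
  have alt: "tri_point v1 v2 v3 (x, y) = v3 + (x *\<^sub>R u + y *\<^sub>R w)" for x y
    by (simp add: tri_point_def uwq algebra_simps)
  \<comment> \<open>Any three plane vectors satisfy this linear relation, here written out by
    coordinates.\<close>
  have "cross2 q w * fst u + cross2 u q * fst w = D * fst q"
       "cross2 q w * snd u + cross2 u q * snd w = D * snd q"
    by (simp_all add: D_def cross2_def algebra_simps)
  then have "(cross2 q w / D) *\<^sub>R u + (cross2 u q / D) *\<^sub>R w = q"
    using D(2) by (simp add: prod_eq_iff add_divide_distrib[symmetric])
  then show ?thesis
    using D(1) by (simp add: alt uwq)
qed

section \<open>Affine changes of variables for plane integrals\<close>

lemma nn_integral_lborel_pair:
  fixes g :: "point \<Rightarrow> ennreal"
  assumes [measurable]: "g \<in> borel_measurable borel"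
  shows "(\<integral>\<^sup>+p. g p \<partial>lborel) = (\<integral>\<^sup>+x. \<integral>\<^sup>+y. g (x, y) \<partial>lborel \<partial>lborel)"
    and "(\<integral>\<^sup>+p. g p \<partial>lborel) = (\<integral>\<^sup>+y. \<integral>\<^sup>+x. g (x, y) \<partial>lborel \<partial>lborel)"
proof -
  have m: "g \<in> borel_measurable (lborel \<Otimes>\<^sub>M lborel)"
    by (simp add: lborel_prod)
  show "(\<integral>\<^sup>+p. g p \<partial>lborel) = (\<integral>\<^sup>+x. \<integral>\<^sup>+y. g (x, y) \<partial>lborel \<partial>lborel)"
    using lborel.nn_integral_fst[OF m] by (simp add: lborel_prod)
  show "(\<integral>\<^sup>+p. g p \<partial>lborel) = (\<integral>\<^sup>+y. \<integral>\<^sup>+x. g (x, y) \<partial>lborel \<partial>lborel)"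
    using lborel_pair.nn_integral_snd[OF m] by (simp add: lborel_prod)
qed

text \<open>The substitution is factored into two one-dimensional ones with pivot \<open>e\<close>:
  the first coordinate is rescaled by \<open>D / e\<close> for fixed second coordinate, then the
  second by \<open>e\<close> for fixed \<open>x\<close>. The factors multiply to the absolute
  determinant.\<close>

lemma nn_integral_affine_pair_pivot:
  fixes g :: "point \<Rightarrow> ennreal" and a b c e :: real
  assumes [measurable]: "g \<in> borel_measurable borel" and e: "e \<noteq> 0" and D: "a * e - b * c \<noteq> 0"
  shows "(\<integral>\<^sup>+p. g p \<partial>lborel) =
    ennreal \<bar>a * e - b * c\<bar> * (\<integral>\<^sup>+x. \<integral>\<^sup>+y. g (r + (a * x + b * y), s + (c * x + e * y)) \<partial>lborel \<partial>lborel)"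
proof -
  define D where "D = a * e - b * c"
  have De: "D / e \<noteq> 0" using e D by (simp add: D_def)
  have [measurable]: "(\<lambda>(x, y). g (u x y, v x y)) \<in> borel_measurable (borel \<Otimes>\<^sub>M borel)"
    if [measurable]: "(\<lambda>(x, y). u x y) \<in> borel_measurable (borel \<Otimes>\<^sub>M borel)"
       "(\<lambda>(x, y). v x y) \<in> borel_measurable (borel \<Otimes>\<^sub>M borel)" for u v :: "real \<Rightarrow> real \<Rightarrow> real"
    using that by (simp add: case_prod_beta')
  have "(\<integral>\<^sup>+p. g p \<partial>lborel) = (\<integral>\<^sup>+q. \<integral>\<^sup>+p. g (p, q) \<partial>lborel \<partial>lborel)"
    by (rule nn_integral_lborel_pair) simp
  also have "\<dots> = (\<integral>\<^sup>+q. ennreal \<bar>D / e\<bar> * (\<integral>\<^sup>+x. g (r + b / e * (q - s) + D / e * x, q) \<partial>lborel) \<partial>lborel)"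
    by (intro nn_integral_cong nn_integral_real_affine De) simp
  also have "\<dots> = ennreal \<bar>D / e\<bar> * (\<integral>\<^sup>+q. \<integral>\<^sup>+x. g (r + b / e * (q - s) + D / e * x, q) \<partial>lborel \<partial>lborel)"
    by (rule nn_integral_cmult) simp
  also have "(\<integral>\<^sup>+q. \<integral>\<^sup>+x. g (r + b / e * (q - s) + D / e * x, q) \<partial>lborel \<partial>lborel)
      = (\<integral>\<^sup>+x. \<integral>\<^sup>+q. g (r + b / e * (q - s) + D / e * x, q) \<partial>lborel \<partial>lborel)"
    by (rule lborel_pair.Fubini') simp
  also have "\<dots> = (\<integral>\<^sup>+x. ennreal \<bar>e\<bar> *
      (\<integral>\<^sup>+y. g (r + b / e * ((s + c * x + e * y) - s) + D / e * x, s + c * x + e * y) \<partial>lborel) \<partial>lborel)"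
    by (intro nn_integral_cong nn_integral_real_affine e) simp
  also have "\<dots> = ennreal \<bar>e\<bar> *
      (\<integral>\<^sup>+x. \<integral>\<^sup>+y. g (r + b / e * ((s + c * x + e * y) - s) + D / e * x, s + c * x + e * y) \<partial>lborel \<partial>lborel)"
    by (rule nn_integral_cmult) simp
  also have "ennreal \<bar>D / e\<bar> * (ennreal \<bar>e\<bar> * z) = ennreal \<bar>D\<bar> * z" for z
    using e by (simp add: mult.assoc[symmetric] ennreal_mult[symmetric] abs_divide)
  finally have 1: "(\<integral>\<^sup>+p. g p \<partial>lborel) = ennreal \<bar>D\<bar> *
      (\<integral>\<^sup>+x. \<integral>\<^sup>+y. g (r + b / e * ((s + c * x + e * y) - s) + D / e * x, s + c * x + e * y) \<partial>lborel \<partial>lborel)" .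
  \<comment> \<open>Composing the two substitutions restores the coefficient of \<open>x\<close>,
    since \<open>b * c / e + D / e = a\<close>.\<close>
  have 2: "r + b / e * ((s + c * x + e * y) - s) + D / e * x = r + (a * x + b * y)" for x y
    using e by (simp add: D_def field_simps)
  show ?thesis unfolding 1 2 by (simp add: D_def add.assoc)
qed

text \<open>If \<open>e = 0\<close>, then \<open>c\<close> is nonzero and serves as pivot once
  \<open>x\<close> and \<open>y\<close> are exchanged; Tonelli's theorem exchanges them
  back.\<close>

lemma nn_integral_affine_pair:
  fixes g :: "point \<Rightarrow> ennreal" and a b c e :: real
  assumes g[measurable]: "g \<in> borel_measurable borel" and D: "a * e - b * c \<noteq> 0"
  shows "(\<integral>\<^sup>+p. g p \<partial>lborel) =
    ennreal \<bar>a * e - b * c\<bar> * (\<integral>\<^sup>+x. \<integral>\<^sup>+y. g (r + (a * x + b * y), s + (c * x + e * y)) \<partial>lborel \<partial>lborel)"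
proof (cases "e = 0")
  case False
  then show ?thesis using nn_integral_affine_pair_pivot[OF g False D] by simp
next
  case True
  with D have c: "c \<noteq> 0" by auto
  have "(\<integral>\<^sup>+p. g p \<partial>lborel) =
    ennreal \<bar>b * c - a * e\<bar> * (\<integral>\<^sup>+x. \<integral>\<^sup>+y. g (r + (b * x + a * y), s + (e * x + c * y)) \<partial>lborel \<partial>lborel)"
    using g c D by (intro nn_integral_affine_pair_pivot) auto
  also have "(\<integral>\<^sup>+x. \<integral>\<^sup>+y. g (r + (b * x + a * y), s + (e * x + c * y)) \<partial>lborel \<partial>lborel)
    = (\<integral>\<^sup>+y. \<integral>\<^sup>+x. g (r + (b * x + a * y), s + (e * x + c * y)) \<partial>lborel \<partial>lborel)"
    by (rule lborel_pair.Fubini') (simp add: case_prod_beta')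
  finally show ?thesis by (simp add: abs_minus_commute add.commute)
qed

lemma nn_integral_tri_point:
  fixes g :: "point \<Rightarrow> ennreal"
  assumes "g \<in> borel_measurable borel" and "tri_det v1 v2 v3 \<noteq> 0"
  shows "(\<integral>\<^sup>+p. g p \<partial>lborel) =
    ennreal \<bar>tri_det v1 v2 v3\<bar> * (\<integral>\<^sup>+x. \<integral>\<^sup>+y. g (tri_point v1 v2 v3 (x, y)) \<partial>lborel \<partial>lborel)"
proof -
  define a b c e where abce: "a = fst v1 - fst v3" "b = fst v2 - fst v3" "c = snd v1 - snd v3" "e = snd v2 - snd v3"
  have D: "tri_det v1 v2 v3 = a * e - b * c"
    by (simp add: tri_det_def cross2_def abce)
  have "tri_point v1 v2 v3 (x, y) = (fst v3 + (a * x + b * y), snd v3 + (c * x + e * y))" for x y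
    by (simp add: tri_point_def prod_eq_iff abce algebra_simps)
  with nn_integral_affine_pair[OF assms(1), of a e b c "fst v3" "snd v3"] assms(2) D
  show ?thesis by simp
qed

section \<open>Beta integrals and the Dirichlet integral over the standard simplex\<close>

text \<open>Integration by parts trades one power of \<open>s - y\<close> for one of
  \<open>y\<close>; the induction on \<open>k\<close> therefore needs \<open>j\<close>
  arbitrary.\<close>

lemma has_integral_beta_nat:
  fixes s :: real
  assumes "0 \<le> s"
  shows "((\<lambda>y. y ^ j * (s - y) ^ k) has_integral
    fact j * fact k / fact (j + k + 1) * s ^ (j + k + 1)) {0..s}"
proof (induction k arbitrary: j)
  case 0
  have "((\<lambda>y. y ^ Suc j / real (Suc j)) has_real_derivative y ^ j) (at y within {0..s})" for y
    by (rule derivative_eq_intros refl | simp del: of_nat_Suc)+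
  then have "((\<lambda>y. y ^ j) has_integral s ^ Suc j / real (Suc j) - 0 ^ Suc j / real (Suc j)) {0..s}"
    using assms
    by (intro fundamental_theorem_of_calculus)
       (auto simp: has_real_derivative_iff_has_vector_derivative[symmetric] simp del: power_Suc)
  then show ?case by simp
next
  case (Suc k)
  \<comment> \<open>\<open>?F\<close> vanishes at both endpoints, so integration by parts leaves no
    boundary term.\<close>
  let ?F = "\<lambda>y. y ^ Suc j * (s - y) ^ Suc k / real (Suc j)"
  let ?f = "\<lambda>y. y ^ j * (s - y) ^ Suc k - real (Suc k) / real (Suc j) * (y ^ Suc j * (s - y) ^ k)"
  have "(?F has_real_derivative ?f y) (at y within {0..s})" for y
    by (rule derivative_eq_intros refl | simp)+ (simp add: field_simps)
  then have "(?f has_integral ?F s - ?F 0) {0..s}"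
    using assms
    by (intro fundamental_theorem_of_calculus)
       (auto simp: has_real_derivative_iff_has_vector_derivative[symmetric] simp del: power_Suc)
  then have "(?f has_integral 0) {0..s}" by simp
  from has_integral_add[OF this has_integral_mult_right[OF Suc.IH[of "Suc j"], of "real (Suc k) / real (Suc j)"]]
  show ?case by (simp add: field_simps del: power_Suc of_nat_Suc)
qed

lemma nn_integral_beta_nat:
  fixes s :: real
  shows "(\<integral>\<^sup>+y. ennreal (y ^ j * (s - y) ^ k) * indicator {0..s} y \<partial>lborel) =
    ennreal (fact j * fact k / fact (j + k + 1) * s ^ (j + k + 1)) * indicator {0..} s"
proof (cases "0 \<le> s")
  case True
  show ?thesis
    using nn_integral_has_integral_lebesgue'[OF _ has_integral_beta_nat[OF True]] True by simp
next
  case False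
  then show ?thesis by (simp add: indicator_def)
qed

text \<open>The inner integral is a Beta integral on \<open>{0..1 - x}\<close> and leaves the power
  \<open>j + k + 1\<close> of \<open>1 - x\<close>; the outer one is again a Beta integral, and
  \<open>fact (j + k + 1)\<close> cancels.\<close>

lemma nn_integral_standard_simplex:
  "(\<integral>\<^sup>+x. \<integral>\<^sup>+y. ennreal (x ^ i * y ^ j * (1 - x - y) ^ k) * indicator {(x, y). 0 \<le> x \<and> 0 \<le> y \<and> x + y \<le> 1} (x, y) \<partial>lborel \<partial>lborel)
    = ennreal (fact i * fact j * fact k / fact (i + j + k + 2))"
proof -
  let ?C = "fact j * fact k / fact (j + k + 1) :: real"
  have "(\<integral>\<^sup>+y. ennreal (x ^ i * y ^ j * (1 - x - y) ^ k) * indicator {(x, y). 0 \<le> x \<and> 0 \<le> y \<and> x + y \<le> 1} (x, y) \<partial>lborel)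
      = ennreal ?C * (ennreal (x ^ i * (1 - x) ^ (j + k + 1)) * indicator {0..1} x)" for x :: real
  proof (cases "0 \<le> x \<and> x \<le> 1")
    case True
    have "(\<integral>\<^sup>+y. ennreal (x ^ i * y ^ j * (1 - x - y) ^ k) * indicator {(x, y). 0 \<le> x \<and> 0 \<le> y \<and> x + y \<le> 1} (x, y) \<partial>lborel)
        = (\<integral>\<^sup>+y. ennreal (x ^ i) * (ennreal (y ^ j * ((1 - x) - y) ^ k) * indicator {0..1 - x} y) \<partial>lborel)"
      using True by (intro nn_integral_cong) (auto simp: indicator_def ennreal_mult'[symmetric] mult.assoc)
    also have "\<dots> = ennreal (x ^ i) * (\<integral>\<^sup>+y. ennreal (y ^ j * ((1 - x) - y) ^ k) * indicator {0..1 - x} y \<partial>lborel)"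
      by (rule nn_integral_cmult) measurable
    also have "\<dots> = ennreal (x ^ i) * ennreal (?C * (1 - x) ^ (j + k + 1))"
      using True by (subst nn_integral_beta_nat) simp
    also have "\<dots> = ennreal ?C * (ennreal (x ^ i * (1 - x) ^ (j + k + 1)) * indicator {0..1} x)"
      using True by (simp add: ennreal_mult'[symmetric] mult_ac del: power_Suc)
    finally show ?thesis .
  next
    case False
    then have "indicator {(x, y). 0 \<le> x \<and> 0 \<le> y \<and> x + y \<le> 1} (x, y) = (0 :: ennreal)"
      "indicator {0..1} x = (0 :: ennreal)" for y
      by (auto simp: indicator_def)
    then show ?thesis by (simp only: mult_zero_right nn_integral_const mult_zero_left)
  qed
  then have "(\<integral>\<^sup>+x. \<integral>\<^sup>+y. ennreal (x ^ i * y ^ j * (1 - x - y) ^ k) * indicator {(x, y). 0 \<le> x \<and> 0 \<le> y \<and> x + y \<le> 1} (x, y) \<partial>lborel \<partial>lborel)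
    = (\<integral>\<^sup>+x. ennreal ?C * (ennreal (x ^ i * (1 - x) ^ (j + k + 1)) * indicator {0..1} x) \<partial>lborel)"
    by simp
  also have "\<dots> = ennreal ?C * (\<integral>\<^sup>+x. ennreal (x ^ i * (1 - x) ^ (j + k + 1)) * indicator {0..1} x \<partial>lborel)"
    by (rule nn_integral_cmult) measurable
  also have "\<dots> = ennreal ?C * ennreal (fact i * fact (j + k + 1) / fact (i + j + k + 2))"
    by (subst nn_integral_beta_nat) (simp add: add.assoc)
  also have "\<dots> = ennreal (?C * (fact i * fact (j + k + 1) / fact (i + j + k + 2)))"
    by (rule ennreal_mult[symmetric]) simp_all
  also have "?C * (fact i * fact (j + k + 1) / fact (i + j + k + 2)) = fact i * fact j * fact k / fact (i + j + k + 2)"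
    by (simp del: fact_Suc)
  finally show ?thesis .
qed

section \<open>Integrals of Bernstein polynomials over the triangle\<close>

text \<open>The three variables are independent, so homogeneity makes sense; the relation that
  barycentric coordinates sum to 1 enters only on composition with
  \<open>barycentric\<close>.\<close>

definition monom3 :: "multi_index \<Rightarrow> real \<times> real \<times> real \<Rightarrow> real" where
  "monom3 = (\<lambda>(i, j, k) (x, y, z). x ^ i * y ^ j * z ^ k)"

text \<open>Replaces the definite description by explicit affine functions, from which continuity
  can be read off.\<close>

lemma barycentric_eq:
  assumes "tri_det v1 v2 v3 \<noteq> 0"
  shows "barycentric v1 v2 v3 p =
    (let x = cross2 (p - v3) (v2 - v3) / tri_det v1 v2 v3; y = cross2 (v1 - v3) (p - v3) / tri_det v1 v2 v3
     in (x, y, 1 - x - y))"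
  using barycentric_tri_point[OF assms] tri_point_surj[OF assms, of p]
  by (metis (no_types, lifting))

text \<open>By uniqueness of barycentric coordinates, the coefficients of any convex combination
  giving the point must be \<open>x\<close>, \<open>y\<close> and \<open>1 - x - y\<close>.\<close>

lemma tri_point_in_hull_iff:
  assumes "tri_det v1 v2 v3 \<noteq> 0"
  shows "tri_point v1 v2 v3 (x, y) \<in> convex hull {v1, v2, v3} \<longleftrightarrow> 0 \<le> x \<and> 0 \<le> y \<and> x + y \<le> 1"
proof
  assume "tri_point v1 v2 v3 (x, y) \<in> convex hull {v1, v2, v3}"
  then obtain u v w where uvw: "0 \<le> u" "0 \<le> v" "0 \<le> w" "u + v + w = 1"
    and eq: "tri_point v1 v2 v3 (x, y) = u *\<^sub>R v1 + v *\<^sub>R v2 + w *\<^sub>R v3"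
    by (auto simp: convex_hull_3)
  have "w = 1 - u - v" using uvw by simp
  then have "tri_point v1 v2 v3 (x, y) = tri_point v1 v2 v3 (u, v)"
    unfolding eq by (simp add: tri_point_def)
  then have "(x, y, 1 - x - y) = (u, v, 1 - u - v)"
    using barycentric_tri_point[OF assms] by metis
  with uvw show "0 \<le> x \<and> 0 \<le> y \<and> x + y \<le> 1" by auto
next
  assume "0 \<le> x \<and> 0 \<le> y \<and> x + y \<le> 1"
  then show "tri_point v1 v2 v3 (x, y) \<in> convex hull {v1, v2, v3}"
    unfolding convex_hull_3 tri_point_def
    by (intro CollectI exI[of _ x] exI[of _ y] exI[of _ "1 - x - y"] conjI) simp_all
qed

text \<open>Pulling back along \<open>tri_point\<close> turns the integrand, extended by zero
  outside the triangle, into the Dirichlet integrand on the standard simplex.\<close>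

lemma has_integral_monom3_triangle:
  assumes D: "tri_det v1 v2 v3 \<noteq> 0"
  shows "((\<lambda>p. monom3 (i, j, k) (barycentric v1 v2 v3 p)) has_integral
    \<bar>tri_det v1 v2 v3\<bar> * (fact i * fact j * fact k / fact (i + j + k + 2))) (convex hull {v1, v2, v3})"
proof -
  let ?T = "convex hull {v1, v2, v3}"
  let ?F = "\<lambda>p. monom3 (i, j, k) (barycentric v1 v2 v3 p)"
  let ?f = "\<lambda>p. if p \<in> ?T then ?F p else 0"
  have F_eq: "?F = (\<lambda>p. (cross2 (p - v3) (v2 - v3) / tri_det v1 v2 v3) ^ i *
      (cross2 (v1 - v3) (p - v3) / tri_det v1 v2 v3) ^ j *
      (1 - cross2 (p - v3) (v2 - v3) / tri_det v1 v2 v3 - cross2 (v1 - v3) (p - v3) / tri_det v1 v2 v3) ^ k)"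
    by (simp add: barycentric_eq[OF D] monom3_def Let_def)
  have "continuous_on UNIV ?F"
    unfolding F_eq cross2_def using D by (intro continuous_intros) auto
  then have [measurable]: "?F \<in> borel_measurable borel"
    by (rule borel_measurable_continuous_onI)
  have "compact ?T" by (simp add: finite_imp_compact_convex_hull)
  then have [measurable]: "?T \<in> sets borel" by (simp add: borel_compact)
  have f_tri: "ennreal (?f (tri_point v1 v2 v3 (x, y))) =
      ennreal (x ^ i * y ^ j * (1 - x - y) ^ k) * indicator {(x, y). 0 \<le> x \<and> 0 \<le> y \<and> x + y \<le> 1} (x, y)" for x y
    by (auto simp: tri_point_in_hull_iff[OF D] barycentric_tri_point[OF D] monom3_def indicator_def)
  \<comment> \<open>Nonnegativity allows the return from the extended nonnegative integral to
    \<open>has_integral\<close>.\<close>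
  have f_nonneg: "0 \<le> ?f p" for p
  proof -
    obtain x y where p: "p = tri_point v1 v2 v3 (x, y)"
      using tri_point_surj[OF D, of p] by metis
    show ?thesis
      by (auto simp: p tri_point_in_hull_iff[OF D] barycentric_tri_point[OF D] monom3_def)
  qed
  have "(\<integral>\<^sup>+p. ennreal (?f p) \<partial>lborel) =
      ennreal \<bar>tri_det v1 v2 v3\<bar> * (\<integral>\<^sup>+x. \<integral>\<^sup>+y. ennreal (?f (tri_point v1 v2 v3 (x, y))) \<partial>lborel \<partial>lborel)"
    by (rule nn_integral_tri_point[OF _ D]) measurable
  also have "\<dots> = ennreal (\<bar>tri_det v1 v2 v3\<bar> * (fact i * fact j * fact k / fact (i + j + k + 2)))"
    unfolding f_tri nn_integral_standard_simplex by (rule ennreal_mult[symmetric]) simp_all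
  finally have "(?f has_integral \<bar>tri_det v1 v2 v3\<bar> * (fact i * fact j * fact k / fact (i + j + k + 2))) UNIV"
    by (intro nn_integral_has_integral f_nonneg) simp_all
  then show ?thesis
    by (simp only: has_integral_restrict_UNIV)
qed

text \<open>The case of the constant monomial, all exponents being 0.\<close>

lemma measure_triangle:
  assumes "tri_det v1 v2 v3 \<noteq> 0"
  shows "measure lebesgue (convex hull {v1, v2, v3}) = \<bar>tri_det v1 v2 v3\<bar> / 2"
proof -
  have "convex hull {v1, v2, v3} \<in> lmeasurable"
    by (intro lmeasurable_compact finite_imp_compact_convex_hull) simp
  moreover have "((\<lambda>p. 1) has_integral \<bar>tri_det v1 v2 v3\<bar> / 2) (convex hull {v1, v2, v3})"
    using has_integral_monom3_triangle[OF assms, of 0 0 0] by (simp add: monom3_def case_prod_beta' fact_2)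
  ultimately show ?thesis
    by (simp add: lmeasure_integral integral_unique)
qed

lemma bernstein_monom3:
  "bernstein d v1 v2 v3 (i, j, k) p =
    fact d / (fact i * fact j * fact k) * monom3 (i, j, k) (barycentric v1 v2 v3 p)"
  by (simp add: bernstein_def monom3_def case_prod_beta' Let_def mult.assoc)

text \<open>The multinomial coefficient cancels the factorials of the Dirichlet integral, so the
  value no longer depends on \<open>t\<close>.\<close>

lemma has_integral_bernstein:
  assumes D: "tri_det v1 v2 v3 \<noteq> 0" and t: "t \<in> indices d"
  shows "(bernstein d v1 v2 v3 t has_integral
    measure lebesgue (convex hull {v1, v2, v3}) / real ((d + 2) choose 2)) (convex hull {v1, v2, v3})"
proof -
  obtain i j k where ijk: "t = (i, j, k)" "i + j + k = d"
    using t by (auto simp: indices_def)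
  have "2 * ((d + 2) choose 2) = (d + 2) * (d + 1)"
    by (simp add: choose_two)
  then have N: "2 * real ((d + 2) choose 2) = (real d + 2) * (real d + 1)"
    by (metis (mono_tags, opaque_lifting) of_nat_mult of_nat_add of_nat_numeral of_nat_1)
  have "fact (d + 2) = 2 * real ((d + 2) choose 2) * fact d"
    unfolding N by (simp add: algebra_simps)
  then have eq: "fact d / (fact i * fact j * fact k) * (\<bar>tri_det v1 v2 v3\<bar> * (fact i * fact j * fact k / fact (d + 2)))
    = measure lebesgue (convex hull {v1, v2, v3}) / real ((d + 2) choose 2)"
    by (simp add: measure_triangle[OF D] del: fact_Suc)
  have "bernstein d v1 v2 v3 t = (\<lambda>p. fact d / (fact i * fact j * fact k) * monom3 (i, j, k) (barycentric v1 v2 v3 p))"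
    by (simp only: fun_eq_iff ijk(1) bernstein_monom3 simp_thms)
  then show ?thesis
    using has_integral_mult_right[OF has_integral_monom3_triangle[OF D, of i j k], of "fact d / (fact i * fact j * fact k)"]
    unfolding ijk(2) eq by (simp only:)
qed

section \<open>Homogeneous forms in three variables and Bernstein expansions\<close>

text \<open>Homogeneous polynomials of degree \<open>d\<close>, kept as functions on
  triples.\<close>

definition forms3 :: "nat \<Rightarrow> (real \<times> real \<times> real \<Rightarrow> real) set" where
  "forms3 d = {f. \<exists>c. f = (\<lambda>b. \<Sum>t\<in>indices d. c t * monom3 t b)}"

lemma finite_indices [simp]: "finite (indices d)"
  unfolding set_lex_indices[symmetric] by simp

lemma forms3_monom3: "t \<in> indices d \<Longrightarrow> monom3 t \<in> forms3 d"
  unfolding forms3_def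
  by (auto intro!: exI[of _ "\<lambda>s. if s = t then 1 else 0"] simp: if_distrib[of "\<lambda>x. x * _"] sum.delta cong: if_cong)

lemma forms3_scale: "f \<in> forms3 d \<Longrightarrow> (\<lambda>b. a * f b) \<in> forms3 d"
  unfolding forms3_def
  by (auto simp: sum_distrib_left mult.assoc[symmetric])

lemma forms3_zero: "(\<lambda>b. 0) \<in> forms3 d"
  unfolding forms3_def by (auto intro!: exI[of _ "\<lambda>_. 0"])

lemma forms3_add: "f \<in> forms3 d \<Longrightarrow> g \<in> forms3 d \<Longrightarrow> (\<lambda>b. f b + g b) \<in> forms3 d"
  unfolding forms3_def
  by (auto simp: sum.distrib[symmetric] distrib_right[symmetric])

lemma forms3_sum: "(\<And>a. a \<in> A \<Longrightarrow> f a \<in> forms3 d) \<Longrightarrow> (\<lambda>b. \<Sum>a\<in>A. f a b) \<in> forms3 d"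
  by (induction A rule: infinite_finite_induct) (auto intro: forms3_zero forms3_add)

lemma forms3_mult:
  assumes "f \<in> forms3 d" and "g \<in> forms3 e"
  shows "(\<lambda>b. f b * g b) \<in> forms3 (d + e)"
proof -
  obtain c c' where f: "f = (\<lambda>b. \<Sum>t\<in>indices d. c t * monom3 t b)"
    and g: "g = (\<lambda>b. \<Sum>s\<in>indices e. c' s * monom3 s b)"
    using assms by (auto simp: forms3_def)
  have mono: "(\<lambda>b. monom3 t b * monom3 s b) \<in> forms3 (d + e)" if "t \<in> indices d" "s \<in> indices e" for t s
  proof -
    obtain i j k i' j' k' where ijk: "t = (i, j, k)" "s = (i', j', k')" by (metis surj_pair)
    have "(\<lambda>b. monom3 t b * monom3 s b) = monom3 (i + i', j + j', k + k')"
      by (auto simp: ijk monom3_def power_add)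
    then show ?thesis
      using that by (auto simp: ijk indices_def intro!: forms3_monom3)
  qed
  have "(\<lambda>b. f b * g b) = (\<lambda>b. \<Sum>t\<in>indices d. \<Sum>s\<in>indices e. c t * (c' s * (monom3 t b * monom3 s b)))"
    unfolding f g sum_product by (intro ext sum.cong refl) (simp only: mult_ac)
  also have "\<dots> \<in> forms3 (d + e)"
    by (intro forms3_sum forms3_scale mono)
  finally show ?thesis .
qed

lemma forms3_linear: "(\<lambda>(x, y, z). a * x + b * y + c * z) \<in> forms3 1"
proof -
  have "(\<lambda>q. a * monom3 (1, 0, 0) q + b * monom3 (0, 1, 0) q + c * monom3 (0, 0, 1) q) \<in> forms3 1"
    by (intro forms3_add forms3_scale forms3_monom3) (auto simp: indices_def)
  then show ?thesis
    by (simp add: monom3_def case_prod_beta')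
qed

lemma forms3_one: "(\<lambda>b. 1) \<in> forms3 0"
  using forms3_monom3[of "(0, 0, 0)" 0] by (simp add: indices_def monom3_def case_prod_beta')

lemma forms3_prod_linear: "(\<And>m. f m \<in> forms3 1) \<Longrightarrow> (\<lambda>b. \<Prod>m<n. f m b) \<in> forms3 n"
proof (induction n)
  case (Suc n)
  then show ?case using forms3_mult[of "\<lambda>b. \<Prod>m<n. f m b" n "f n" 1] by simp
qed (simp add: forms3_one)

lemma forms3_power: "f \<in> forms3 1 \<Longrightarrow> (\<lambda>b. f b ^ n) \<in> forms3 n"
  using forms3_prod_linear[of "\<lambda>_. f" n] by simp

text \<open>On barycentric triples the linear forms \<open>X\<close> and \<open>Y\<close> return the
  Cartesian coordinates and \<open>S\<close> is 1, so powers of \<open>S\<close> raise every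
  monomial to degree \<open>d\<close> without changing its value.\<close>

lemma bivariate_polys_forms3:
  assumes D: "tri_det v1 v2 v3 \<noteq> 0" and p: "p \<in> bivariate_polys d"
  shows "\<exists>f \<in> forms3 d. \<forall>q. p q = f (barycentric v1 v2 v3 q)"
proof -
  obtain c where c: "p = (\<lambda>(x, y). \<Sum>(a, b) \<in> {(a, b). a + b \<le> d}. c a b * x ^ a * y ^ b)"
    using p by (auto simp: bivariate_polys_def)
  define X Y S :: "real \<times> real \<times> real \<Rightarrow> real" where
    "X = (\<lambda>(x, y, z). fst v1 * x + fst v2 * y + fst v3 * z)" and
    "Y = (\<lambda>(x, y, z). snd v1 * x + snd v2 * y + snd v3 * z)" and
    "S = (\<lambda>(x, y, z). 1 * x + 1 * y + 1 * z)"
  have XYS: "X \<in> forms3 1" "Y \<in> forms3 1" "S \<in> forms3 1"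
    unfolding X_def Y_def S_def by (rule forms3_linear)+
  define f where "f = (\<lambda>q. \<Sum>ab \<in> {(a, b). a + b \<le> d}.
    c (fst ab) (snd ab) * (X q ^ fst ab * Y q ^ snd ab * S q ^ (d - fst ab - snd ab)))"
  have "(\<lambda>q. X q ^ a * Y q ^ b * S q ^ (d - a - b)) \<in> forms3 d" if "a + b \<le> d" for a b
  proof -
    have "(\<lambda>q. X q ^ a * Y q ^ b * S q ^ (d - a - b)) \<in> forms3 (a + b + (d - a - b))"
      by (intro forms3_mult forms3_power XYS)
    with that show ?thesis by simp
  qed
  then have "f \<in> forms3 d"
    unfolding f_def by (intro forms3_sum forms3_scale) auto
  moreover have "p q = f (barycentric v1 v2 v3 q)" for q
  proof -
    obtain x y where q: "q = tri_point v1 v2 v3 (x, y)"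
      using tri_point_surj[OF D, of q] by metis
    have b: "barycentric v1 v2 v3 q = (x, y, 1 - x - y)"
      unfolding q by (rule barycentric_tri_point[OF D])
    have "X (barycentric v1 v2 v3 q) = fst q" "Y (barycentric v1 v2 v3 q) = snd q"
      "S (barycentric v1 v2 v3 q) = 1"
      unfolding b by (simp_all add: q X_def Y_def S_def tri_point_def mult.commute)
    then show ?thesis
      by (simp add: c f_def case_prod_beta' mult.assoc)
  qed
  ultimately show ?thesis by blast
qed

text \<open>Bernstein polynomials are nonzero multiples of the monomials in barycentric coordinates,
  so the coefficients are merely rescaled.\<close>

lemma forms3_bernstein:
  assumes "f \<in> forms3 d"
  shows "\<exists>c. \<forall>p. f (barycentric v1 v2 v3 p) = (\<Sum>t\<in>indices d. c t * bernstein d v1 v2 v3 t p)"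
proof -
  obtain c where c: "f = (\<lambda>b. \<Sum>t\<in>indices d. c t * monom3 t b)"
    using assms by (auto simp: forms3_def)
  show ?thesis
    unfolding c
    by (rule exI[of _ "\<lambda>(i, j, k). c (i, j, k) * (fact i * fact j * fact k / fact d)"])
       (auto simp: bernstein_monom3 intro!: sum.cong)
qed

section \<open>Lagrange interpolation at the domain points\<close>

lemma barycentric_domain_point:
  assumes "tri_det v1 v2 v3 \<noteq> 0" and "d \<ge> 1" and "i + j + k = d"
  shows "barycentric v1 v2 v3 (domain_point d v1 v2 v3 (i, j, k)) = (real i / d, real j / d, real k / d)"
proof -
  have k: "1 - real i / d - real j / d = real k / d"
  proof -
    have "real i / d + real j / d + real k / d = real d / d"
      using assms(3) by (simp flip: add_divide_distrib of_nat_add)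
    with assms(2) show ?thesis by simp
  qed
  have "domain_point d v1 v2 v3 (i, j, k) = tri_point v1 v2 v3 (real i / d, real j / d)"
    unfolding domain_point_def tri_point_def prod.case k
    by (simp add: scaleR_add_right divide_inverse mult.commute)
  then show ?thesis
    using barycentric_tri_point[OF assms(1)] k by simp
qed

text \<open>Each factor \<open>(d b\<^sub>1 - m) / (i - m)\<close> of the Lagrange polynomials on the principal lattice is
  homogenised by replacing \<open>m\<close> with \<open>m (b\<^sub>1 + b\<^sub>2 + b\<^sub>3)\<close>.\<close>
lemma forms3_lagrange:
  assumes D: "tri_det v1 v2 v3 \<noteq> 0" and d: "d \<ge> 1" and t: "t \<in> indices d"
  shows "\<exists>f \<in> forms3 d. \<forall>s \<in> indices d.
    f (barycentric v1 v2 v3 (domain_point d v1 v2 v3 s)) = (if s = t then 1 else 0)"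
proof -
  obtain i j k where ijk: "t = (i, j, k)" "i + j + k = d"
    using t by (auto simp: indices_def)
  define l1 l2 l3 :: "nat \<Rightarrow> real \<times> real \<times> real \<Rightarrow> real" where
    "l1 = (\<lambda>m (x, y, z). ((real d - real m) / (real i - real m)) * x + (- real m / (real i - real m)) * y + (- real m / (real i - real m)) * z)" and
    "l2 = (\<lambda>m (x, y, z). (- real m / (real j - real m)) * x + ((real d - real m) / (real j - real m)) * y + (- real m / (real j - real m)) * z)" and
    "l3 = (\<lambda>m (x, y, z). (- real m / (real k - real m)) * x + (- real m / (real k - real m)) * y + ((real d - real m) / (real k - real m)) * z)"
  define f where "f = (\<lambda>b. (\<Prod>m<i. l1 m b) * (\<Prod>m<j. l2 m b) * (\<Prod>m<k. l3 m b))"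
  have "f \<in> forms3 (i + j + k)"
    unfolding f_def l1_def l2_def l3_def by (intro forms3_mult forms3_prod_linear forms3_linear)
  moreover have "f (barycentric v1 v2 v3 (domain_point d v1 v2 v3 s)) = (if s = t then 1 else 0)"
    if s: "s \<in> indices d" for s
  proof -
    obtain a b c where abc: "s = (a, b, c)" "a + b + c = d"
      using s by (auto simp: indices_def)
    have bary: "barycentric v1 v2 v3 (domain_point d v1 v2 v3 s) = (real a / d, real b / d, real c / d)"
      unfolding abc(1) by (rule barycentric_domain_point[OF D d abc(2)])
    have dr: "real d = real a + real b + real c" "real d \<noteq> 0"
      using abc(2) d by auto
    \<comment> \<open>Here \<open>n\<close> may be 0, as happens for \<open>m = i\<close> below;
      both sides are then 0 because division by zero yields 0.\<close>
    have aux: "(real d - m) / n * (u / d) + (- m / n) * (v / d) + (- m / n) * (w / d) = (u - m) / n"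
      if "u + v + w = real d" for m n u v w :: real
    proof -
      have "(real d - m) / n * (u / d) + (- m / n) * (v / d) + (- m / n) * (w / d) =
        (real d * u - m * (u + v + w)) / (n * d)"
        by (simp add: field_simps add_divide_distrib diff_divide_distrib)
      also have "real d * u - m * (u + v + w) = (u - m) * real d"
        unfolding that by (simp add: algebra_simps)
      also have "(u - m) * real d / (n * real d) = (u - m) / n"
        using dr(2) by simp
      finally show ?thesis .
    qed
    have "l1 m (real a / d, real b / d, real c / d) = (real a - real m) / (real i - real m)"
      "l2 m (real a / d, real b / d, real c / d) = (real b - real m) / (real j - real m)"
      "l3 m (real a / d, real b / d, real c / d) = (real c - real m) / (real k - real m)" for m
      using aux[of a b c m "real i - real m"] aux[of b a c m "real j - real m"] aux[of c a b m "real k - real m"] dr(1)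
      unfolding l1_def l2_def l3_def prod.case by argo+
    then have f: "f (barycentric v1 v2 v3 (domain_point d v1 v2 v3 s)) =
      (\<Prod>m<i. (real a - real m) / (real i - real m)) * (\<Prod>m<j. (real b - real m) / (real j - real m)) *
      (\<Prod>m<k. (real c - real m) / (real k - real m))"
      by (simp add: f_def bary)
    show ?thesis
    proof (cases "s = t")
      case True
      then show ?thesis unfolding f using abc ijk by (auto intro!: prod.neutral)
    next
      case False
      \<comment> \<open>Both triples sum to \<open>d\<close>, so if they differ, some component of
        \<open>s\<close> lies below that of \<open>t\<close>; the factor whose \<open>m\<close>
        equals that component vanishes.\<close>
      then have "a < i \<or> b < j \<or> c < k"
        using abc ijk by auto
      then show ?thesis unfolding f using False by (auto simp: prod_zero_iff)
    qed
  qed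
  ultimately show ?thesis using ijk(2) by blast
qed

section \<open>Lexicographic enumeration and invertibility of the collocation matrix\<close>

lemma distinct_lex_indices: "distinct (lex_indices d)"
proof -
  have "(t, t) \<notin> less_than <*lex*> less_than <*lex*> less_than" for t :: multi_index
    by (cases t) simp
  then show ?thesis
    using sorted_lex_indices[of d]
    unfolding distinct_conv_nth sorted_wrt_iff_nth_less by (metis nat_neq_iff)
qed

lemma bij_betw_lex_indices: "bij_betw ((!) (lex_indices d)) {..<(d + 2) choose 2} (indices d)"
  by (rule bij_betw_nth) (simp_all add: distinct_lex_indices length_lex_indices set_lex_indices)

lemma sum_lex_indices: "(\<Sum>m<(d + 2) choose 2. h (lex_indices d ! m)) = (\<Sum>t\<in>indices d. h t)"
  by (rule sum.reindex_bij_betw[OF bij_betw_lex_indices])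

lemma lex_pos_nth: "m < (d + 2) choose 2 \<Longrightarrow> lex_pos d (lex_indices d ! m) = m"
  unfolding lex_pos_def
  by (rule the_equality) (auto simp: length_lex_indices nth_eq_iff_index_eq[OF distinct_lex_indices])

text \<open>For square matrices a right inverse is also a left inverse, so \<open>B\<close> is a
  unit of the matrix ring and \<open>mat_inverse\<close> cannot return \<open>None\<close>.\<close>

lemma collocation_mat_inverse:
  assumes D: "tri_det v1 v2 v3 \<noteq> 0" and d: "d \<ge> 1"
  defines "N \<equiv> (d + 2) choose 2" and "B \<equiv> collocation_mat d v1 v2 v3"
  shows "the (mat_inverse B) * B = 1\<^sub>m N \<and> the (mat_inverse B) \<in> carrier_mat N N"
proof -
  have B: "B \<in> carrier_mat N N"
    by (simp add: B_def N_def collocation_mat_def)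
  have "\<exists>c. \<forall>s \<in> indices d. (\<Sum>u\<in>indices d. c u * bernstein d v1 v2 v3 u (domain_point d v1 v2 v3 s))
      = (if s = t then 1 else 0)" if "t \<in> indices d" for t
    using forms3_lagrange[OF D d that] forms3_bernstein[of _ d v1 v2 v3] by metis
  then obtain c where c: "\<And>s t. s \<in> indices d \<Longrightarrow> t \<in> indices d \<Longrightarrow>
      (\<Sum>u\<in>indices d. c t u * bernstein d v1 v2 v3 u (domain_point d v1 v2 v3 s)) = (if s = t then 1 else 0)"
    by metis
  \<comment> \<open>Column \<open>l\<close> holds the Bernstein coefficients of the Lagrange
    polynomial of the \<open>l\<close>-th domain point.\<close>
  define C where "C = Matrix.mat N N (\<lambda>(r, l). c (lex_indices d ! l) (lex_indices d ! r))"
  have C: "C \<in> carrier_mat N N" by (simp add: C_def)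
  have nth: "lex_indices d ! r \<in> indices d" if "r < N" for r
    using that nth_mem[of r "lex_indices d"] by (simp add: set_lex_indices length_lex_indices N_def)
  have BC: "B * C = 1\<^sub>m N"
  proof (rule eq_matI)
    fix r l assume rl: "r < dim_row (1\<^sub>m N)" "l < dim_col (1\<^sub>m N)"
    then have "(B * C) $$ (r, l) = (\<Sum>m<N. c (lex_indices d ! l) (lex_indices d ! m) *
        bernstein d v1 v2 v3 (lex_indices d ! m) (domain_point d v1 v2 v3 (lex_indices d ! r)))"
      using B C by (simp add: scalar_prod_def B_def C_def collocation_mat_def N_def lessThan_atLeast0 mult.commute)
    also have "\<dots> = (\<Sum>u\<in>indices d. c (lex_indices d ! l) u *
        bernstein d v1 v2 v3 u (domain_point d v1 v2 v3 (lex_indices d ! r)))"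
      unfolding N_def by (rule sum_lex_indices)
    also have "\<dots> = (if lex_indices d ! r = lex_indices d ! l then 1 else 0)"
      using rl by (intro c nth) simp_all
    also have "\<dots> = 1\<^sub>m N $$ (r, l)"
      using rl by (simp add: nth_eq_iff_index_eq[OF distinct_lex_indices] length_lex_indices N_def)
    finally show "(B * C) $$ (r, l) = 1\<^sub>m N $$ (r, l)" .
  qed (use B C in simp_all)
  have "C * B = 1\<^sub>m N" by (rule mat_mult_left_right_inverse[OF B C BC])
  with BC B C have "B \<in> Units (ring_mat TYPE(real) N ())"
    by (auto simp: Units_def ring_mat_def)
  with mat_inverse(1)[OF B, where b = "()"] obtain B' where "mat_inverse B = Some B'"
    by (cases "mat_inverse B") auto
  with mat_inverse(2)[OF B this] show ?thesis by simp
qed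

theorem theorem3p1:
  fixes v1 v2 v3 :: "real \<times> real" and d :: nat
  assumes "\<not> collinear {v1, v2, v3}"
    and "d \<ge> 1"
  shows "\<forall>p \<in> bivariate_polys d.
    (\<Sum>t \<in> indices d. weight d v1 v2 v3 t * p (domain_point d v1 v2 v3 t))
      = integral (convex hull {v1, v2, v3}) p"
proof
  fix p assume p: "p \<in> bivariate_polys d"
  note D = tri_det_nonzero[OF assms(1)]
  define N where "N = (d + 2) choose 2"
  define B where "B = collocation_mat d v1 v2 v3"
  define I where "I = the (mat_inverse B)"
  define K where "K = measure lebesgue (convex hull {v1, v2, v3}) / real N"
  let ?L = "\<lambda>m. lex_indices d ! m"
  have B: "B \<in> carrier_mat N N"
    by (simp add: B_def N_def collocation_mat_def)
  have I: "I * B = 1\<^sub>m N" "I \<in> carrier_mat N N"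
    using collocation_mat_inverse[OF D assms(2)] by (simp_all add: I_def B_def N_def)
  obtain c where c: "\<And>q. p q = (\<Sum>t\<in>indices d. c t * bernstein d v1 v2 v3 t q)"
    using bivariate_polys_forms3[OF D p] forms3_bernstein[of _ d v1 v2 v3] by metis
  have p_at: "p (domain_point d v1 v2 v3 (?L l)) = (\<Sum>m<N. B $$ (l, m) * c (?L m))" if "l < N" for l
  proof -
    have "p (domain_point d v1 v2 v3 (?L l)) = (\<Sum>m<N. c (?L m) * bernstein d v1 v2 v3 (?L m) (domain_point d v1 v2 v3 (?L l)))"
      unfolding c N_def by (rule sum_lex_indices[symmetric])
    also have "\<dots> = (\<Sum>m<N. B $$ (l, m) * c (?L m))"
      using that by (intro sum.cong refl) (simp add: B_def collocation_mat_def N_def)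
    finally show ?thesis .
  qed
  \<comment> \<open>The left inverse property, entry by entry: the column sums of \<open>I\<close>
    act on \<open>B\<close> from the left.\<close>
  have IB: "(\<Sum>l<N. I $$ (r, l) * B $$ (l, m)) = (if r = m then 1 else 0)" if "r < N" "m < N" for r m
  proof -
    have "(\<Sum>l<N. I $$ (r, l) * B $$ (l, m)) = (I * B) $$ (r, m)"
      using that B I(2) by (simp add: scalar_prod_def lessThan_atLeast0)
    then show ?thesis using that by (simp add: I(1))
  qed
  have "(\<Sum>t \<in> indices d. weight d v1 v2 v3 t * p (domain_point d v1 v2 v3 t))
      = (\<Sum>l<N. weight d v1 v2 v3 (?L l) * p (domain_point d v1 v2 v3 (?L l)))"
    unfolding N_def by (rule sum_lex_indices[symmetric])
  \<comment> \<open>Since \<open>lex_pos\<close> undoes the enumeration, the weight at position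
    \<open>l\<close> is \<open>K\<close> times the \<open>l\<close>-th column sum of
    \<open>I\<close>.\<close>
  also have "\<dots> = (\<Sum>l<N. K * (\<Sum>r<N. I $$ (r, l)) * (\<Sum>m<N. B $$ (l, m) * c (?L m)))"
  proof (rule sum.cong[OF refl])
    fix l assume "l \<in> {..<N}"
    then show "weight d v1 v2 v3 (?L l) * p (domain_point d v1 v2 v3 (?L l)) =
        K * (\<Sum>r<N. I $$ (r, l)) * (\<Sum>m<N. B $$ (l, m) * c (?L m))"
      using I(2) p_at[of l] lex_pos_nth[of l d, folded N_def]
      by (simp add: weight_def column_sum_def K_def flip: N_def B_def I_def del: add_2_eq_Suc')
  qed
  also have "\<dots> = (\<Sum>l<N. \<Sum>r<N. \<Sum>m<N. K * c (?L m) * (I $$ (r, l) * B $$ (l, m)))"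
    unfolding mult.assoc sum_product unfolding sum_distrib_left
    by (intro sum.cong refl) (simp only: mult_ac)
  \<comment> \<open>Two exchanges move the sum over \<open>l\<close> innermost, where
    \<open>IB\<close> contracts it to a Kronecker delta.\<close>
  also have "\<dots> = (\<Sum>r<N. \<Sum>l<N. \<Sum>m<N. K * c (?L m) * (I $$ (r, l) * B $$ (l, m)))"
    by (rule sum.swap)
  also have "\<dots> = (\<Sum>r<N. \<Sum>m<N. \<Sum>l<N. K * c (?L m) * (I $$ (r, l) * B $$ (l, m)))"
    by (intro sum.cong refl sum.swap)
  also have "\<dots> = (\<Sum>r<N. \<Sum>m<N. K * c (?L m) * (if r = m then 1 else 0))"
    by (intro sum.cong refl) (simp only: sum_distrib_left[symmetric] IB lessThan_iff)
  also have "\<dots> = (\<Sum>r<N. K * c (?L r))"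
    by (simp add: if_distrib[of "\<lambda>x. _ * x"] sum.delta cong: if_cong)
  also have "\<dots> = (\<Sum>t\<in>indices d. c t * K)"
    using sum_lex_indices[of "\<lambda>t. c t * K" d] by (simp add: N_def mult.commute)
  also have "\<dots> = integral (convex hull {v1, v2, v3}) p"
  proof -
    \<comment> \<open>Every Bernstein polynomial has the same integral \<open>K\<close>, so
      integrating the expansion termwise gives the coefficient sum times \<open>K\<close>.\<close>
    have "((\<lambda>q. \<Sum>t\<in>indices d. c t * bernstein d v1 v2 v3 t q) has_integral (\<Sum>t\<in>indices d. c t * K))
        (convex hull {v1, v2, v3})"
      unfolding K_def N_def
      by (intro has_integral_sum has_integral_mult_right has_integral_bernstein[OF D]) simp_all
    then show ?thesis
      by (simp add: c[abs_def] integral_unique)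
  qed
  finally show "(\<Sum>t \<in> indices d. weight d v1 v2 v3 t * p (domain_point d v1 v2 v3 t))
      = integral (convex hull {v1, v2, v3}) p" .
qed

end
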